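(* For each $n\in\mathbb{N}$ let $\mathcal{F}_n\subseteq \mathcal{C}^\infty(\mathbb{R}^n)$ be a set of smooth functions $\mathbb{R}^n\to\mathbb{R}$, and let $\mathcal{A}$ be the expansion of the ordered real field $(\mathbb{R},<,+,\cdot,0,1)$ by the functions in $\bigcup_{n\in\mathbb{N}}\mathcal{F}_n$. Suppose $\mathcal{A}$ is o-minimal. Then the commutative ring with unity $\mathcal{H}_{\mathcal{A}}$ of germs at $+\infty$ of definable $\mathcal{C}^\infty$ unary functions is a Hardy field, and $\mathcal{H}_{\mathcal{A}}$ is isomorphic (as a ring with unity) to a subfield of (the underlying ring of) some $\mathcal{C}^\infty$-ring.
   Context: "Definable" means first-order definable in $\mathcal{A}$ with parameters from $\mathbb{R}$. A structure expanding $(\mathbb{R},<)$ is o-minimal if every definable subset of $\mathbb{R}$ is a finite union of points and open intervals. A definable $\mathcal{C}^\infty$ unary function is a definable smooth function $f\colon (c,+\infty)\to\mathbb{R}$ for some $c\in\mathbb{R}\cup\{-\infty\}$. Two continuous functions $f,g$ whose domains contain some interval $(c,+\infty)$ have the same germ at $+\infty$, $[f]=[g]$, if they agree on some interval $(a,+\infty)$; germs are added and multiplied pointwise. A Hardy field is a set of germs at $+\infty$ of continuous real functions which is a field under these operations and is closed under differentiation (if $[f]$ is in it then $[f']$ is in it). A $\mathcal{C}^\infty$-ring is a set $A$ with operations $\Phi_f\colon A^m\to A$ for every $m\ge 0$ and every smooth $f\colon\mathbb{R}^m\to\mathbb{R}$, such that $\Phi_{\pi_j}$ is the $j$-th projection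 $A^m\to A$ for each coordinate projection $\pi_j\colon\mathbb{R}^m\to\mathbb{R}$, and whenever $h=g\circ(f_1,\dots,f_n)$ with $f_i\colon\mathbb{R}^m\to\mathbb{R}$, $g\colon\mathbb{R}^n\to\mathbb{R}$ smooth, one has $\Phi_h(c_1,\dots,c_m)=\Phi_g(\Phi_{f_1}(c_1,\dots,c_m),\dots,\Phi_{f_n}(c_1,\dots,c_m))$ for all $c_i\in A$; in particular its underlying set is a commutative ring via $\Phi_+$, $\Phi_\cdot$. *)

theory Defs
  imports "HOL-Analysis.Analysis" "HOL-Algebra.QuotRing" "HOL-Algebra.Subrings"
begin

section \<open>Smooth functions\<close>

text \<open>
  A tuple in \<open>A\<^sup>n\<close> is a list of length \<open>n\<close> with entries in \<open>A\<close>, and a function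
  of \<open>n\<close> real variables is a function on real lists, of which only the values at
  lists of length \<open>n\<close> are ever used.
\<close>

definition partial_deriv :: "nat \<Rightarrow> (real list \<Rightarrow> real) \<Rightarrow> real list \<Rightarrow> real" where
  "partial_deriv i f x = deriv (\<lambda>t. f (x[i := t])) (x ! i)"

definition partially_differentiable :: "nat \<Rightarrow> (real list \<Rightarrow> real) \<Rightarrow> bool" where
  "partially_differentiable n f \<longleftrightarrow>
     (\<forall>i<n. \<forall>x. length x = n \<longrightarrow> (\<lambda>t. f (x[i := t])) field_differentiable at (x ! i))"

definition continuous_fun :: "nat \<Rightarrow> (real list \<Rightarrow> real) \<Rightarrow> bool" where
  "continuous_fun n f \<longleftrightarrow>
     continuous_map (Euclidean_space n) euclideanreal (\<lambda>x. f (map x [0..<n]))"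

text \<open>All iterated partial derivatives (including \<open>f\<close> itself) exist and are continuous.\<close>

definition Cinf :: "nat \<Rightarrow> (real list \<Rightarrow> real) set" where
  "Cinf n = {f. \<forall>js. set js \<subseteq> {..<n} \<longrightarrow>
                  continuous_fun n (foldr partial_deriv js f) \<and>
                  partially_differentiable n (foldr partial_deriv js f)}"

definition open_interval :: "ereal \<Rightarrow> ereal \<Rightarrow> real set" where
  "open_interval a b = {x. a < ereal x \<and> ereal x < b}"

text \<open>Meant for open sets \<open>S\<close> only, where \<open>deriv\<close> depends just on the values of \<open>f\<close> on \<open>S\<close>.\<close>

definition smooth_on_open :: "real set \<Rightarrow> (real \<Rightarrow> real) \<Rightarrow> bool" where
  "smooth_on_open S f \<longleftrightarrow> (\<forall>k. \<forall>x\<in>S. (deriv ^^ k) f field_differentiable at x)"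


section \<open>First-order definability\<close>

text \<open>
  Terms and formulas of the language of ordered rings with additional function symbols;
  the symbol of arity \<open>n\<close> naming a function \<open>f\<close> of \<open>n\<close> variables is the pair \<open>n\<close>, \<open>f\<close>.
\<close>

datatype tm =
    Var nat
  | Zero
  | One
  | Plus tm tm
  | Times tm tm
  | App nat "real list \<Rightarrow> real" "tm list"

datatype fm =
    Equal tm tm
  | Less tm tm
  | Neg fm
  | Conj fm fm
  | Exists nat fm

primrec tm_val :: "(nat \<Rightarrow> real) \<Rightarrow> tm \<Rightarrow> real" where
  "tm_val e (Var i) = e i"
| "tm_val e Zero = 0"
| "tm_val e One = 1"
| "tm_val e (Plus s t) = tm_val e s + tm_val e t"
| "tm_val e (Times s t) = tm_val e s * tm_val e t"
| "tm_val e (App n f ts) = f (map (tm_val e) ts)"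

primrec sat :: "(nat \<Rightarrow> real) \<Rightarrow> fm \<Rightarrow> bool" where
  "sat e (Equal s t) \<longleftrightarrow> tm_val e s = tm_val e t"
| "sat e (Less s t) \<longleftrightarrow> tm_val e s < tm_val e t"
| "sat e (Neg \<phi>) \<longleftrightarrow> \<not> sat e \<phi>"
| "sat e (Conj \<phi> \<psi>) \<longleftrightarrow> sat e \<phi> \<and> sat e \<psi>"
| "sat e (Exists i \<phi>) \<longleftrightarrow> (\<exists>a. sat (e(i := a)) \<phi>)"

text \<open>Being a term or formula of the language with function symbols from \<open>F\<close>.\<close>

primrec tm_over :: "(nat \<Rightarrow> (real list \<Rightarrow> real) set) \<Rightarrow> tm \<Rightarrow> bool" where
  "tm_over F (Var i) \<longleftrightarrow> True"
| "tm_over F Zero \<longleftrightarrow> True"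
| "tm_over F One \<longleftrightarrow> True"
| "tm_over F (Plus s t) \<longleftrightarrow> tm_over F s \<and> tm_over F t"
| "tm_over F (Times s t) \<longleftrightarrow> tm_over F s \<and> tm_over F t"
| "tm_over F (App n f ts) \<longleftrightarrow> f \<in> F n \<and> length ts = n \<and> list_all (tm_over F) ts"

primrec fm_over :: "(nat \<Rightarrow> (real list \<Rightarrow> real) set) \<Rightarrow> fm \<Rightarrow> bool" where
  "fm_over F (Equal s t) \<longleftrightarrow> tm_over F s \<and> tm_over F t"
| "fm_over F (Less s t) \<longleftrightarrow> tm_over F s \<and> tm_over F t"
| "fm_over F (Neg \<phi>) \<longleftrightarrow> fm_over F \<phi>"
| "fm_over F (Conj \<phi> \<psi>) \<longleftrightarrow> fm_over F \<phi> \<and> fm_over F \<psi>"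
| "fm_over F (Exists i \<phi>) \<longleftrightarrow> fm_over F \<phi>"

text \<open>
  Variables \<open>0, \<dots>, n - 1\<close> range over the tuple; the free variables from \<open>n\<close> on are
  interpreted by the real parameters \<open>p\<close>, of which a formula uses only finitely many.
\<close>

definition definable :: "(nat \<Rightarrow> (real list \<Rightarrow> real) set) \<Rightarrow> nat \<Rightarrow> real list set \<Rightarrow> bool" where
  "definable F n D \<longleftrightarrow>
     (\<exists>\<phi> p. fm_over F \<phi> \<and>
        D = {xs. length xs = n \<and> sat (\<lambda>i. if i < n then xs ! i else p (i - n)) \<phi>})"

definition definable_fun_on ::
  "(nat \<Rightarrow> (real list \<Rightarrow> real) set) \<Rightarrow> real set \<Rightarrow> (real \<Rightarrow> real) \<Rightarrow> bool" where
  "definable_fun_on F S f \<longleftrightarrow> definable F 2 {[x, f x] | x. x \<in> S}"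

definition o_minimal :: "(nat \<Rightarrow> (real list \<Rightarrow> real) set) \<Rightarrow> bool" where
  "o_minimal F \<longleftrightarrow>
     (\<forall>S. definable F 1 {[x] | x. x \<in> S} \<longrightarrow>
        (\<exists>P \<I>. finite P \<and> finite \<I> \<and> (\<forall>I\<in>\<I>. \<exists>a b. I = open_interval a b) \<and>
               S = P \<union> \<Union>\<I>))"


section \<open>Germs at infinity and Hardy fields\<close>

text \<open>
  A function whose domain contains some \<open>(c, \<infinity>)\<close> is represented by any total extension;
  the germ does not depend on the extension.
\<close>

definition germ :: "(real \<Rightarrow> real) \<Rightarrow> (real \<Rightarrow> real) set" where
  "germ f = {g. \<exists>a. \<forall>x>a. f x = g x}"

definition germ_ring :: "(real \<Rightarrow> real) set ring" where
  "germ_ring =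
     \<lparr>carrier = {germ f | f. \<exists>c. continuous_on {c<..} f},
      monoid.mult = (\<lambda>G H. \<Union>f\<in>G. \<Union>g\<in>H. germ (\<lambda>x. f x * g x)),
      one = germ (\<lambda>_. 1),
      zero = germ (\<lambda>_. 0),
      add = (\<lambda>G H. \<Union>f\<in>G. \<Union>g\<in>H. germ (\<lambda>x. f x + g x))\<rparr>"

lemma germ_eq_iff: "germ f = germ g \<longleftrightarrow> (\<exists>a. \<forall>x>a. f x = g x)"
proof
  assume "germ f = germ g"
  moreover have "g \<in> germ g" by (auto simp: germ_def)
  ultimately show "\<exists>a. \<forall>x>a. f x = g x" by (auto simp: germ_def)
next
  assume "\<exists>a. \<forall>x>a. f x = g x"
  then obtain a where a: "\<And>x. x > a \<Longrightarrow> f x = g x" by blast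
  have "h \<in> germ f \<longleftrightarrow> h \<in> germ g" for h
  proof
    assume "h \<in> germ f"
    then obtain b where "\<And>x. x > b \<Longrightarrow> f x = h x" by (auto simp: germ_def)
    with a have "\<forall>x>max a b. g x = h x" by (metis max_less_iff_conj)
    then show "h \<in> germ g" unfolding germ_def by blast
  next
    assume "h \<in> germ g"
    then obtain b where "\<And>x. x > b \<Longrightarrow> g x = h x" by (auto simp: germ_def)
    with a have "\<forall>x>max a b. f x = h x" by (metis max_less_iff_conj)
    then show "h \<in> germ f" unfolding germ_def by blast
  qed
  then show "germ f = germ g" by blast
qed

lemma germ_pointwise:
  "(\<Union>f'\<in>germ f. \<Union>g'\<in>germ g. germ (\<lambda>x. opr (f' x) (g' x))) = germ (\<lambda>x. opr (f x) (g x))"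
proof -
  have "germ (\<lambda>x. opr (f' x) (g' x)) = germ (\<lambda>x. opr (f x) (g x))"
    if "f' \<in> germ f" "g' \<in> germ g" for f' g'
  proof -
    from that obtain a b where "\<And>x. x > a \<Longrightarrow> f x = f' x" "\<And>x. x > b \<Longrightarrow> g x = g' x"
      by (auto simp: germ_def)
    then have "\<forall>x>max a b. opr (f' x) (g' x) = opr (f x) (g x)" by auto
    then show ?thesis unfolding germ_eq_iff by blast
  qed
  moreover have "f \<in> germ f" "g \<in> germ g" by (auto simp: germ_def)
  ultimately show ?thesis by blast
qed

lemma mult_germ_ring: "germ f \<otimes>\<^bsub>germ_ring\<^esub> germ g = germ (\<lambda>x. f x * g x)"
  by (simp add: germ_ring_def germ_pointwise)

lemma add_germ_ring: "germ f \<oplus>\<^bsub>germ_ring\<^esub> germ g = germ (\<lambda>x. f x + g x)"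
  by (simp add: germ_ring_def germ_pointwise)

definition hardy_field :: "(real \<Rightarrow> real) set set \<Rightarrow> bool" where
  "hardy_field H \<longleftrightarrow>
     H \<subseteq> carrier germ_ring \<and>
     field (germ_ring\<lparr>carrier := H\<rparr>) \<and>
     (\<forall>f. germ f \<in> H \<longrightarrow>
        (\<exists>c. \<forall>x>c. f field_differentiable at x) \<and> germ (deriv f) \<in> H)"

definition smooth_unary_germs ::
  "(nat \<Rightarrow> (real list \<Rightarrow> real) set) \<Rightarrow> (real \<Rightarrow> real) set set" where
  "smooth_unary_germs F =
     {germ f | f. \<exists>c. c \<noteq> \<infinity> \<and> definable_fun_on F (open_interval c \<infinity>) f \<and>
                      smooth_on_open (open_interval c \<infinity>) f}"


section \<open>Smooth rings\<close>

text \<open>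
  The operation of the ring for \<open>f \<in> Cinf m\<close> is \<open>\<Phi> m f\<close>.  In the composition axiom, equality of
  functions on \<open>m\<close>-tuples is equality at lists of length \<open>m\<close>; taking \<open>g\<close> to be the
  projection of one variable, it follows that \<open>\<Phi> m f\<close> depends only on the values of \<open>f\<close>
  at such lists.
\<close>

locale cinf_ring =
  fixes A :: "'a set" and \<Phi> :: "nat \<Rightarrow> (real list \<Rightarrow> real) \<Rightarrow> 'a list \<Rightarrow> 'a"
  assumes closed:
    "\<lbrakk>f \<in> Cinf m; length cs = m; set cs \<subseteq> A\<rbrakk> \<Longrightarrow> \<Phi> m f cs \<in> A"
  and projection:
    "\<lbrakk>j < m; length cs = m; set cs \<subseteq> A\<rbrakk> \<Longrightarrow> \<Phi> m (\<lambda>x. x ! j) cs = cs ! j"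
  and composition:
    "\<lbrakk>set fs \<subseteq> Cinf m; length fs = n; g \<in> Cinf n;
      \<And>x. length x = m \<Longrightarrow> h x = g (map (\<lambda>f. f x) fs);
      length cs = m; set cs \<subseteq> A\<rbrakk>
     \<Longrightarrow> \<Phi> m h cs = \<Phi> n g (map (\<lambda>f. \<Phi> m f cs) fs)"

definition underlying_ring ::
  "'a set \<Rightarrow> (nat \<Rightarrow> (real list \<Rightarrow> real) \<Rightarrow> 'a list \<Rightarrow> 'a) \<Rightarrow> 'a ring" where
  "underlying_ring A \<Phi> =
     \<lparr>carrier = A,
      monoid.mult = (\<lambda>a b. \<Phi> 2 (\<lambda>x. x ! 0 * x ! 1) [a, b]),
      one = \<Phi> 0 (\<lambda>_. 1) [],
      zero = \<Phi> 0 (\<lambda>_. 0) [],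
      add = (\<lambda>a b. \<Phi> 2 (\<lambda>x. x ! 0 + x ! 1) [a, b])\<rparr>"

end

theory Submission
  imports Defs
begin

text \<open>
  The zero set of a definable function is definable, so by o-minimality a definable function is
  eventually zero or eventually nonzero; hence a nonzero germ has an inverse. The derivative
  is definable through its \<open>\<epsilon>\<close>-\<open>\<delta>\<close> characterisation. As the \<open>C\<^sup>\<infinity>\<close>-ring one can take the germs of
  all functions, with smooth functions acting pointwise: no regularity of the germs is
  needed for the axioms, and the ring structure is pointwise addition and multiplication.
\<close>

section \<open>Closure properties of definability\<close>

primrec rename_tm :: "(nat \<Rightarrow> nat) \<Rightarrow> tm \<Rightarrow> tm" where
  "rename_tm \<rho> (Var i) = Var (\<rho> i)"
| "rename_tm \<rho> Zero = Zero"
| "rename_tm \<rho> One = One"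
| "rename_tm \<rho> (Plus s t) = Plus (rename_tm \<rho> s) (rename_tm \<rho> t)"
| "rename_tm \<rho> (Times s t) = Times (rename_tm \<rho> s) (rename_tm \<rho> t)"
| "rename_tm \<rho> (App n f ts) = App n f (map (rename_tm \<rho>) ts)"

primrec rename_fm :: "(nat \<Rightarrow> nat) \<Rightarrow> fm \<Rightarrow> fm" where
  "rename_fm \<rho> (Equal s t) = Equal (rename_tm \<rho> s) (rename_tm \<rho> t)"
| "rename_fm \<rho> (Less s t) = Less (rename_tm \<rho> s) (rename_tm \<rho> t)"
| "rename_fm \<rho> (Neg \<phi>) = Neg (rename_fm \<rho> \<phi>)"
| "rename_fm \<rho> (Conj \<phi> \<psi>) = Conj (rename_fm \<rho> \<phi>) (rename_fm \<rho> \<psi>)"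
| "rename_fm \<rho> (Exists i \<phi>) = Exists (\<rho> i) (rename_fm \<rho> \<phi>)"

lemma tm_val_rename: "tm_val e (rename_tm \<rho> t) = tm_val (e \<circ> \<rho>) t"
  by (induction t) (auto cong: map_cong)

lemma tm_over_rename: "tm_over F (rename_tm \<rho> t) = tm_over F t"
  by (induction t) (auto simp: list_all_iff)

text \<open>Bound variables are renamed too, so injectivity is what prevents capture: a new value
  for \<open>\<rho> i\<close> must change no variable other than \<open>i\<close> in
  \<open>e \<circ> \<rho>\<close>.\<close>

lemma sat_rename:
  assumes "inj \<rho>"
  shows "sat e (rename_fm \<rho> \<phi>) = sat (e \<circ> \<rho>) \<phi>"
proof (induction \<phi> arbitrary: e)
  case (Exists i \<phi>)
  have "e(\<rho> i := a) \<circ> \<rho> = (e \<circ> \<rho>)(i := a)" for a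
    using assms by (auto simp: fun_eq_iff inj_eq)
  with Exists show ?case by (simp only: rename_fm.simps sat.simps)
qed (simp_all add: tm_val_rename)

lemma fm_over_rename: "fm_over F (rename_fm \<rho> \<phi>) = fm_over F \<phi>"
  by (induction \<phi>) (auto simp: tm_over_rename)

definition interleave :: "(nat \<Rightarrow> real) \<Rightarrow> (nat \<Rightarrow> real) \<Rightarrow> nat \<Rightarrow> real" where
  "interleave e p i = (if even i then e (i div 2) else p (i div 2))"

lemma interleave_upd: "interleave (e(i := a)) p = (interleave e p)(2 * i := a)"
  by (auto simp: interleave_def fun_eq_iff elim: oddE)

text \<open>
  In \<open>interleave\<close>, even variables are free and odd variables hold the parameters, so that every variable index is
  available to a predicate on environments and the arity plays no role until the end.
\<close>

definition def_pred :: "(nat \<Rightarrow> (real list \<Rightarrow> real) set) \<Rightarrow> ((nat \<Rightarrow> real) \<Rightarrow> bool) \<Rightarrow> bool" where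
  "def_pred F P \<longleftrightarrow> (\<exists>\<phi> p. fm_over F \<phi> \<and> (\<forall>e. P e = sat (interleave e p) \<phi>))"

definition def_term :: "(nat \<Rightarrow> (real list \<Rightarrow> real) set) \<Rightarrow> ((nat \<Rightarrow> real) \<Rightarrow> real) \<Rightarrow> bool" where
  "def_term F t \<longleftrightarrow> (\<exists>\<tau> p. tm_over F \<tau> \<and> (\<forall>e. t e = tm_val (interleave e p) \<tau>))"

text \<open>Even (free) variables stay fixed, while parameter \<open>j\<close> moves to position
  \<open>2 * j\<close> under \<open>par1\<close> and to \<open>2 * j + 1\<close> under
  \<open>par2\<close>. Two parameter sequences thus fit into the single sequence
  \<open>interleave p q\<close>.\<close>

definition par1 :: "nat \<Rightarrow> nat" where "par1 i = (if even i then i else 4 * (i div 2) + 1)"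
definition par2 :: "nat \<Rightarrow> nat" where "par2 i = (if even i then i else 4 * (i div 2) + 3)"

lemma inj_par1: "inj par1"
  by (rule injI) (auto simp: par1_def split: if_splits elim!: evenE oddE, presburger+)

lemma inj_par2: "inj par2"
  by (rule injI) (auto simp: par2_def split: if_splits elim!: evenE oddE, presburger+)

lemma interleave_par1: "interleave e (interleave p q) \<circ> par1 = interleave e p"
proof -
  have "odd (par1 i)" "even (par1 i div 2)" "par1 i div 2 div 2 = i div 2" if "odd i" for i
    unfolding par1_def using that by presburger+
  moreover have "par1 i = i" if "even i" for i
    using that by (simp add: par1_def)
  ultimately show ?thesis by (simp add: interleave_def fun_eq_iff)
qed

lemma interleave_par2: "interleave e (interleave p q) \<circ> par2 = interleave e q"
proof -
  have "(4 * k + 3) div 2 = 2 * k + 1" for k :: nat by presburger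
  then show ?thesis by (simp add: interleave_def par2_def fun_eq_iff)
qed

section \<open>Closure properties of definable terms and predicates\<close>

lemma def_term_var: "def_term F (\<lambda>e. e i)"
  unfolding def_term_def by (rule exI[of _ "Var (2 * i)"]) (simp add: interleave_def)

lemma def_term_const: "def_term F (\<lambda>e. r)"
  unfolding def_term_def
  by (rule exI[of _ "Var 1"], rule exI[of _ "\<lambda>_. r"]) (simp add: interleave_def)

text \<open>Each term comes with its own parameters; \<open>par1\<close> and \<open>par2\<close>
  make them read disjoint slots of one sequence, so that both can occur in one formula.\<close>

lemma def_term_common_params:
  assumes "def_term F s" "def_term F t"
  obtains \<sigma> \<tau> p where "tm_over F \<sigma>" "tm_over F \<tau>"
    "\<And>e. s e = tm_val (interleave e p) \<sigma>" "\<And>e. t e = tm_val (interleave e p) \<tau>"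
proof -
  from assms obtain \<sigma> p \<tau> q where "tm_over F \<sigma>" "\<And>e. s e = tm_val (interleave e p) \<sigma>"
    "tm_over F \<tau>" "\<And>e. t e = tm_val (interleave e q) \<tau>"
    unfolding def_term_def by blast
  then show thesis
    by (intro that[of "rename_tm par1 \<sigma>" "rename_tm par2 \<tau>" "interleave p q"])
      (simp_all add: tm_over_rename tm_val_rename interleave_par1 interleave_par2)
qed

lemma def_term_plus:
  assumes "def_term F s" "def_term F t"
  shows "def_term F (\<lambda>e. s e + t e)"
proof -
  from assms obtain \<sigma> \<tau> p where "tm_over F \<sigma>" "tm_over F \<tau>"
    "\<And>e. s e = tm_val (interleave e p) \<sigma>" "\<And>e. t e = tm_val (interleave e p) \<tau>"
    by (rule def_term_common_params) blast
  then show ?thesis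
    unfolding def_term_def by (intro exI[of _ "Plus \<sigma> \<tau>"] exI[of _ p]) simp
qed

lemma def_term_times:
  assumes "def_term F s" "def_term F t"
  shows "def_term F (\<lambda>e. s e * t e)"
proof -
  from assms obtain \<sigma> \<tau> p where "tm_over F \<sigma>" "tm_over F \<tau>"
    "\<And>e. s e = tm_val (interleave e p) \<sigma>" "\<And>e. t e = tm_val (interleave e p) \<tau>"
    by (rule def_term_common_params) blast
  then show ?thesis
    unfolding def_term_def by (intro exI[of _ "Times \<sigma> \<tau>"] exI[of _ p]) simp
qed

lemma def_pred_eq:
  assumes "def_term F s" "def_term F t"
  shows "def_pred F (\<lambda>e. s e = t e)"
proof -
  from assms obtain \<sigma> \<tau> p where "tm_over F \<sigma>" "tm_over F \<tau>"
    "\<And>e. s e = tm_val (interleave e p) \<sigma>" "\<And>e. t e = tm_val (interleave e p) \<tau>"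
    by (rule def_term_common_params) blast
  then show ?thesis
    unfolding def_pred_def by (intro exI[of _ "Equal \<sigma> \<tau>"] exI[of _ p]) simp
qed

lemma def_pred_less:
  assumes "def_term F s" "def_term F t"
  shows "def_pred F (\<lambda>e. s e < t e)"
proof -
  from assms obtain \<sigma> \<tau> p where "tm_over F \<sigma>" "tm_over F \<tau>"
    "\<And>e. s e = tm_val (interleave e p) \<sigma>" "\<And>e. t e = tm_val (interleave e p) \<tau>"
    by (rule def_term_common_params) blast
  then show ?thesis
    unfolding def_pred_def by (intro exI[of _ "Less \<sigma> \<tau>"] exI[of _ p]) simp
qed

lemma def_pred_not: "def_pred F P \<Longrightarrow> def_pred F (\<lambda>e. \<not> P e)"
  unfolding def_pred_def by (metis fm_over.simps(3) sat.simps(3))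

lemma def_pred_conj:
  assumes "def_pred F P" "def_pred F Q"
  shows "def_pred F (\<lambda>e. P e \<and> Q e)"
proof -
  from assms obtain \<phi> p \<psi> q where "fm_over F \<phi>" "\<And>e. P e = sat (interleave e p) \<phi>"
    "fm_over F \<psi>" "\<And>e. Q e = sat (interleave e q) \<psi>"
    unfolding def_pred_def by blast
  then show ?thesis
    unfolding def_pred_def
    by (intro exI[of _ "Conj (rename_fm par1 \<phi>) (rename_fm par2 \<psi>)"] exI[of _ "interleave p q"])
      (simp add: fm_over_rename sat_rename inj_par1 inj_par2 interleave_par1 interleave_par2)
qed

lemma def_pred_imp:
  assumes "def_pred F P" "def_pred F Q"
  shows "def_pred F (\<lambda>e. P e \<longrightarrow> Q e)"
  using def_pred_not[OF def_pred_conj[OF assms(1) def_pred_not[OF assms(2)]]] by simp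

text \<open>The quantified value is a separate argument of \<open>P\<close>, and the second
  hypothesis says that variable \<open>k\<close> is fresh for \<open>P\<close>. Its slot
  \<open>2 * k\<close> can then serve as the bound variable.\<close>

lemma def_pred_ex:
  assumes "def_pred F (\<lambda>e. P e (e k))" and "\<And>e a b. P (e(k := a)) b = P e b"
  shows "def_pred F (\<lambda>e. \<exists>a. P e a)"
proof -
  from assms(1) obtain \<phi> p where \<phi>: "fm_over F \<phi>" "\<And>e. P e (e k) = sat (interleave e p) \<phi>"
    unfolding def_pred_def by blast
  have "P e a = sat ((interleave e p)(2 * k := a)) \<phi>" for e a
    using \<phi>(2)[of "e(k := a)"] by (simp add: assms(2) interleave_upd)
  then have "(\<exists>a. P e a) = sat (interleave e p) (Exists (2 * k) \<phi>)" for e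
    by (simp only: sat.simps)
  with \<phi>(1) show ?thesis
    unfolding def_pred_def by (intro exI[of _ "Exists (2 * k) \<phi>"] exI[of _ p]) simp
qed

lemma def_pred_all:
  assumes "def_pred F (\<lambda>e. P e (e k))" and "\<And>e a b. P (e(k := a)) b = P e b"
  shows "def_pred F (\<lambda>e. \<forall>a. P e a)"
proof -
  have "def_pred F (\<lambda>e. \<not> (\<exists>a. \<not> P e a))"
    by (intro def_pred_not def_pred_ex[where k = k] assms) (simp add: assms(2))
  then show ?thesis by simp
qed

text \<open>Raising the even slots and leaving the parameters alone frees the indices below
  \<open>k\<close>.\<close>

lemma def_pred_shift:
  assumes "def_pred F P"
  shows "def_pred F (\<lambda>e. P (\<lambda>i. e (k + i)))"
proof -
  from assms obtain \<phi> p where \<phi>: "fm_over F \<phi>" "\<And>e. P e = sat (interleave e p) \<phi>"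
    unfolding def_pred_def by blast
  define \<rho> where "\<rho> i = (if even i then 2 * k + i else i)" for i :: nat
  have "inj \<rho>"
    by (rule injI) (auto simp: \<rho>_def split: if_splits)
  moreover have "interleave e p \<circ> \<rho> = interleave (\<lambda>i. e (k + i)) p" for e
    by (auto simp: interleave_def \<rho>_def fun_eq_iff)
  ultimately show ?thesis
    unfolding def_pred_def using \<phi>
    by (intro exI[of _ "rename_fm \<rho> \<phi>"] exI[of _ p]) (simp add: fm_over_rename sat_rename)
qed

text \<open>
  Since \<open>i\<close> and \<open>j\<close> may coincide or clash with 0 and 1, the arguments of \<open>R\<close> are first moved to
  fresh variables, which are then set equal to \<open>i\<close> and \<open>j\<close>.
\<close>

lemma def_pred_subst2:
  assumes "def_pred F (\<lambda>e. R (e 0) (e 1))"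
  shows "def_pred F (\<lambda>e. R (e i) (e j))"
proof -
  define k where "k = Suc (max i j)"
  then have k: "i \<noteq> k" "j \<noteq> k" "i \<noteq> Suc k" "j \<noteq> Suc k" by auto
  have "def_pred F (\<lambda>e. R (e k) (e (Suc k)))"
    using def_pred_shift[OF assms, of k] by simp
  then have "def_pred F (\<lambda>e. \<exists>a. \<exists>b. a = e i \<and> b = e j \<and> R a b)"
    by (intro def_pred_ex[where k = k] def_pred_ex[where k = "Suc k"] def_pred_conj
        def_pred_eq def_term_var) (simp_all add: k)
  then show ?thesis by simp
qed

section \<open>From definable sets of tuples to predicates on environments and back\<close>

lemma def_pred_of_definable:
  assumes "definable F n D"
  shows "def_pred F (\<lambda>e. map e [0..<n] \<in> D)"
proof -
  from assms obtain \<phi> p where \<phi>: "fm_over F \<phi>"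
      "D = {xs. length xs = n \<and> sat (\<lambda>i. if i < n then xs ! i else p (i - n)) \<phi>}"
    unfolding definable_def by blast
  \<comment> \<open>Tuple entries go to even slots; the parameters, which begin at index
    \<open>n\<close>, go to odd slots.\<close>
  define \<rho> where "\<rho> i = (if i < n then 2 * i else 2 * (i - n) + 1)" for i
  have "inj \<rho>"
    by (rule injI) (auto simp: \<rho>_def split: if_splits; presburger)
  moreover have "interleave e p \<circ> \<rho> = (\<lambda>i. if i < n then map e [0..<n] ! i else p (i - n))" for e
    by (auto simp: interleave_def \<rho>_def fun_eq_iff)
  ultimately show ?thesis
    unfolding def_pred_def using \<phi>
    by (intro exI[of _ "rename_fm \<rho> \<phi>"] exI[of _ p]) (simp add: fm_over_rename sat_rename)
qed

lemma definable_of_def_pred: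
  assumes "def_pred F (\<lambda>e. Q (map e [0..<n]))"
  shows "definable F n {xs. length xs = n \<and> Q xs}"
proof -
  from assms obtain \<phi> p where \<phi>: "fm_over F \<phi>" "\<And>e. Q (map e [0..<n]) = sat (interleave e p) \<phi>"
    unfolding def_pred_def by blast
  define \<rho> where "\<rho> i = (if even i \<and> i div 2 < n then i div 2 else i + n)" for i
  \<comment> \<open>Odd numbers carry \<open>p\<close>. Even numbers get 0, matching the default
    value of \<open>e\<close> below; this is harmless because \<open>Q\<close> reads only the first
    \<open>n\<close> variables.\<close>
  define q where "q i = (if even i then 0 else p (i div 2))" for i :: nat
  have inj: "inj \<rho>"
    by (rule injI) (auto simp: \<rho>_def split: if_splits)
  have "sat (\<lambda>i. if i < n then xs ! i else q (i - n)) (rename_fm \<rho> \<phi>) = Q xs"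
    if "length xs = n" for xs
  proof -
    define e where "e i = (if i < n then xs ! i else 0)" for i
    have "map e [0..<n] = xs"
      using that by (intro nth_equalityI) (simp_all add: e_def)
    moreover have "(\<lambda>i. if i < n then xs ! i else q (i - n)) \<circ> \<rho> = interleave e p"
      by (auto simp: interleave_def \<rho>_def q_def e_def fun_eq_iff)
    ultimately show ?thesis
      using \<phi>(2)[of e] inj by (simp add: sat_rename)
  qed
  then show ?thesis
    unfolding definable_def using \<phi>(1)
    by (intro exI[of _ "rename_fm \<rho> \<phi>"] exI[of _ q]) (auto simp: fm_over_rename)
qed

lemma definable_fun_on_iff:
  "definable_fun_on F S f \<longleftrightarrow> def_pred F (\<lambda>e. e 0 \<in> S \<and> e 1 = f (e 0))"
proof -
  have eq: "map e [0..<2] = [e 0, e 1]" for e :: "nat \<Rightarrow> real"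
    by (simp add: upt_rec)
  have set: "{[x, f x] | x. x \<in> S} =
      {xs. length xs = 2 \<and> (xs ! 0 \<in> S \<and> xs ! 1 = f (xs ! 0))}"
    by (auto simp: length_Suc_conv numeral_2_eq_2)
  show ?thesis
  proof
    assume "definable_fun_on F S f"
    then have "def_pred F (\<lambda>e. map e [0..<2] \<in> {[x, f x] | x. x \<in> S})"
      unfolding definable_fun_on_def by (rule def_pred_of_definable)
    then show "def_pred F (\<lambda>e. e 0 \<in> S \<and> e 1 = f (e 0))"
      by (simp add: eq set)
  next
    assume "def_pred F (\<lambda>e. e 0 \<in> S \<and> e 1 = f (e 0))"
    then show "definable_fun_on F S f"
      unfolding definable_fun_on_def set by (intro definable_of_def_pred) (simp add: eq)
  qed
qed

lemma definable_1_of_def_pred: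
  assumes "def_pred F (\<lambda>e. e 0 \<in> S)"
  shows "definable F 1 {[x] | x. x \<in> S}"
proof -
  have "{[x] | x. x \<in> S} = {xs. length xs = 1 \<and> xs ! 0 \<in> S}"
    by (auto simp: length_Suc_conv)
  with assms show ?thesis by (auto intro!: definable_of_def_pred)
qed

section \<open>Definable functions\<close>

lemma definable_fun_on_subset:
  assumes "definable_fun_on F S f" "def_pred F (\<lambda>e. e 0 \<in> T)" "T \<subseteq> S"
  shows "definable_fun_on F T f"
proof -
  have "def_pred F (\<lambda>e. e 0 \<in> T \<and> (e 0 \<in> S \<and> e 1 = f (e 0)))"
    using assms(1,2) unfolding definable_fun_on_iff by (intro def_pred_conj[of F "\<lambda>e. e 0 \<in> T"])
  then show ?thesis
    unfolding definable_fun_on_iff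
    by (rule back_subst[of "def_pred F"]) (use assms(3) in auto)
qed

lemma def_pred_greaterThan: "def_pred F (\<lambda>e. e 0 \<in> {a<..})"
  by (simp add: def_pred_less def_term_const def_term_var)

lemma definable_fun_on_greaterThan_mono:
  assumes "definable_fun_on F {a<..} f" "a \<le> b"
  shows "definable_fun_on F {b<..} f"
  using assms by (intro definable_fun_on_subset[OF assms(1) def_pred_greaterThan]) auto

lemma definable_fun_on_const: "definable_fun_on F {a<..} (\<lambda>_. r)"
  unfolding definable_fun_on_iff
  by (intro def_pred_conj def_pred_greaterThan def_pred_eq def_term_var def_term_const)

text \<open>A definable \<open>f\<close> need not be given by a term, so its values enter formulas
  through the graph, at any two variables.\<close>

lemma def_pred_graph:
  assumes "definable_fun_on F S f"
  shows "def_pred F (\<lambda>e. e i \<in> S \<and> e j = f (e i))"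
  using assms unfolding definable_fun_on_iff by (rule def_pred_subst2)

text \<open>The two values are first named by quantifiers over variables 2 and 3 and then combined;
  hence the indices in the hypothesis on \<open>opr\<close>.\<close>

lemma definable_fun_on_binop:
  assumes f: "definable_fun_on F S f" and g: "definable_fun_on F S g"
    and opr: "def_pred F (\<lambda>e. e 1 = opr (e 2) (e 3))"
  shows "definable_fun_on F S (\<lambda>x. opr (f x) (g x))"
proof -
  have "def_pred F (\<lambda>e. \<exists>u v. (e 0 \<in> S \<and> u = f (e 0)) \<and> (e 0 \<in> S \<and> v = g (e 0)) \<and> e 1 = opr u v)"
    by (intro def_pred_ex[where k = 2] def_pred_ex[where k = 3] def_pred_conj
        def_pred_graph[OF f] def_pred_graph[OF g] opr) simp_all
  then show ?thesis
    unfolding definable_fun_on_iff by (rule back_subst[of "def_pred F"]) auto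
qed

lemma definable_fun_on_add:
  assumes "definable_fun_on F S f" "definable_fun_on F S g"
  shows "definable_fun_on F S (\<lambda>x. f x + g x)"
  by (rule definable_fun_on_binop[OF assms]) (intro def_pred_eq def_term_var def_term_plus)

lemma definable_fun_on_mult:
  assumes "definable_fun_on F S f" "definable_fun_on F S g"
  shows "definable_fun_on F S (\<lambda>x. f x * g x)"
  by (rule definable_fun_on_binop[OF assms]) (intro def_pred_eq def_term_var def_term_times)

text \<open>As \<open>f\<close> has no zero on \<open>S\<close>, the reciprocal is singled out by a
  product equal to 1, which needs no division symbol.\<close>

lemma definable_fun_on_inverse:
  assumes f: "definable_fun_on F S f" and nz: "\<And>x. x \<in> S \<Longrightarrow> f x \<noteq> 0"
  shows "definable_fun_on F S (\<lambda>x. inverse (f x))"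
proof -
  have "def_pred F (\<lambda>e. \<exists>u. (e 0 \<in> S \<and> u = f (e 0)) \<and> u * e 1 = 1)"
    by (intro def_pred_ex[where k = 2] def_pred_conj def_pred_graph[OF f] def_pred_eq
        def_term_times def_term_var def_term_const) simp_all
  moreover have "(e 0 \<in> S \<and> e 1 = inverse (f (e 0))) \<longleftrightarrow>
      (\<exists>u. (e 0 \<in> S \<and> u = f (e 0)) \<and> u * e 1 = 1)" for e :: "nat \<Rightarrow> real"
    using nz[of "e 0"] by (auto simp: field_simps)
  ultimately show ?thesis
    unfolding definable_fun_on_iff by simp
qed

text \<open>
  One-sided increments suffice as the derivative exists, and no subtraction or division occurs,
  so that the condition is a first-order formula.
\<close>

lemma deriv_eq_iff_right_increments:
  fixes f :: "real \<Rightarrow> real"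
  assumes "f field_differentiable at x"
  shows "y = deriv f x \<longleftrightarrow> (\<forall>\<epsilon>. 0 < \<epsilon> \<longrightarrow> (\<exists>\<delta>. 0 < \<delta> \<and> (\<forall>h. 0 < h \<and> h < \<delta> \<longrightarrow>
           f (x + h) < f x + (y + \<epsilon>) * h \<and> f x + y * h < f (x + h) + \<epsilon> * h)))"
    (is "_ \<longleftrightarrow> ?Q")
proof -
  define q where "q h = (f (x + h) - f x) / h" for h
  have lim: "(q \<longlongrightarrow> deriv f x) (at_right 0)"
    using field_differentiable_derivI[OF assms] unfolding DERIV_def q_def
    by (rule tendsto_mono[rotated]) (simp add: at_le)
  have "dist (q h) y < \<epsilon> \<longleftrightarrow>
      f (x + h) < f x + (y + \<epsilon>) * h \<and> f x + y * h < f (x + h) + \<epsilon> * h" if "h > 0" for h \<epsilon>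
    using that by (auto simp: q_def dist_real_def abs_less_iff field_simps)
  then have "?Q \<longleftrightarrow> (q \<longlongrightarrow> y) (at_right 0)"
    unfolding tendsto_iff eventually_at_right_field by (auto simp: Ball_def) meson+
  also have "\<dots> \<longleftrightarrow> y = deriv f x"
    using lim tendsto_unique[OF trivial_limit_at_right_real] by blast
  finally show ?thesis by simp
qed

lemma definable_fun_on_deriv:
  assumes f: "definable_fun_on F {c<..} f" and d: "\<And>x. x > c \<Longrightarrow> f field_differentiable at x"
  shows "definable_fun_on F {c<..} (deriv f)"
proof -
  \<comment> \<open>Every value of \<open>f\<close> becomes a quantified variable: \<open>u\<close>
    at the point itself and \<open>v\<close> at the auxiliary point \<open>w\<close>, which stays in
    the domain because \<open>h\<close> is positive.\<close>
  have "def_pred F (\<lambda>e. c < e 0 \<and> (\<forall>\<epsilon>. 0 < \<epsilon> \<longrightarrow> (\<exists>\<delta>. 0 < \<delta> \<and> (\<forall>h. 0 < h \<and> h < \<delta> \<longrightarrow>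
      (\<exists>u w v. (e 0 \<in> {c<..} \<and> u = f (e 0)) \<and> w = e 0 + h \<and> (w \<in> {c<..} \<and> v = f w) \<and>
        v < u + (e 1 + \<epsilon>) * h \<and> u + e 1 * h < v + \<epsilon> * h)))))"
    by (intro def_pred_all[where k = 2] def_pred_ex[where k = 3] def_pred_all[where k = 4]
        def_pred_ex[where k = 5] def_pred_ex[where k = 6] def_pred_ex[where k = 7]
        def_pred_conj def_pred_imp def_pred_graph[OF f] def_pred_eq def_pred_less
        def_term_times def_term_plus def_term_var def_term_const) simp_all
  then show ?thesis
    unfolding definable_fun_on_iff
    by (rule back_subst[of "def_pred F"])
      (auto simp: fun_eq_iff deriv_eq_iff_right_increments[OF d] cong: conj_cong)
qed

section \<open>Behaviour of definable sets at infinity\<close>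

lemma eventually_open_interval:
  "eventually (\<lambda>x. x \<in> open_interval l u) at_top \<or> eventually (\<lambda>x. x \<notin> open_interval l u) at_top"
proof (cases u)
  case (real r)
  have "eventually (\<lambda>x. x \<notin> open_interval l u) at_top"
    using eventually_ge_at_top[of r] by eventually_elim (auto simp: open_interval_def real)
  then show ?thesis ..
next
  case PInf
  show ?thesis
  proof (cases l)
    case (real r)
    have "eventually (\<lambda>x. x \<in> open_interval l u) at_top"
      using eventually_gt_at_top[of r] by eventually_elim (auto simp: open_interval_def real PInf)
    then show ?thesis ..
  qed (simp_all add: open_interval_def PInf)
qed (simp add: open_interval_def)

text \<open>One interval that eventually contains everything settles the matter; otherwise the
  finitely many intervals and points are all left behind beyond a common bound.\<close>

lemma o_minimal_eventually:
  assumes "o_minimal F" "def_pred F (\<lambda>e. e 0 \<in> S)"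
  shows "eventually (\<lambda>x. x \<in> S) at_top \<or> eventually (\<lambda>x. x \<notin> S) at_top"
proof -
  from assms obtain P \<I> where fin: "finite P" "finite \<I>"
    and I: "\<forall>I\<in>\<I>. \<exists>a b. I = open_interval a b" and S: "S = P \<union> \<Union>\<I>"
    unfolding o_minimal_def using definable_1_of_def_pred by meson
  show ?thesis
  proof (cases "\<exists>I\<in>\<I>. eventually (\<lambda>x. x \<in> I) at_top")
    case True
    then obtain I where I: "I \<in> \<I>" "eventually (\<lambda>x. x \<in> I) at_top" by blast
    from I(2) have "eventually (\<lambda>x. x \<in> S) at_top"
      by eventually_elim (use S I in blast)
    then show ?thesis ..
  next
    case False
    then have "\<forall>I\<in>\<I>. eventually (\<lambda>x. x \<notin> I) at_top"
      using I eventually_open_interval by metis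
    then have "eventually (\<lambda>x. \<forall>I\<in>\<I>. x \<notin> I) at_top"
      by (rule eventually_ball_finite[OF fin(2)])
    moreover have "eventually (\<lambda>x. \<forall>p\<in>P. x \<noteq> p) at_top"
      by (intro eventually_ball_finite fin(1) ballI eventually_mono[OF eventually_gt_at_top]) blast
    ultimately have "eventually (\<lambda>x. x \<notin> S) at_top"
      by eventually_elim (use S in blast)
    then show ?thesis ..
  qed
qed

lemma o_minimal_zeros:
  assumes "o_minimal F" "definable_fun_on F {a<..} f"
  shows "eventually (\<lambda>x. f x = 0) at_top \<or> eventually (\<lambda>x. f x \<noteq> 0) at_top"
proof -
  \<comment> \<open>The graph is available only over \<open>{a<..}\<close>, so the zero set is cut
    down to that ray, without effect at infinity.\<close>
  have "def_pred F (\<lambda>e. \<exists>u. (e 0 \<in> {a<..} \<and> u = f (e 0)) \<and> u = 0)"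
    by (intro def_pred_ex[where k = 1] def_pred_conj def_pred_graph[OF assms(2)] def_pred_eq
        def_term_var def_term_const) simp_all
  then have "def_pred F (\<lambda>e. e 0 \<in> {x. x > a \<and> f x = 0})"
    by (rule back_subst[of "def_pred F"]) auto
  from o_minimal_eventually[OF assms(1) this] show ?thesis
  proof
    assume "eventually (\<lambda>x. x \<in> {x. x > a \<and> f x = 0}) at_top"
    then have "eventually (\<lambda>x. f x = 0) at_top" by eventually_elim simp
    then show ?thesis ..
  next
    assume "eventually (\<lambda>x. x \<notin> {x. x > a \<and> f x = 0}) at_top"
    with eventually_gt_at_top[of a] have "eventually (\<lambda>x. f x \<noteq> 0) at_top"
      by eventually_elim simp
    then show ?thesis ..
  qed
qed

section \<open>Smooth functions of one variable\<close>

text \<open>Bounding the order permits induction: derivatives of products and reciprocals again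
  involve products and reciprocals, but at one order less.\<close>

definition times_differentiable :: "nat \<Rightarrow> real set \<Rightarrow> (real \<Rightarrow> real) \<Rightarrow> bool" where
  "times_differentiable n S f \<longleftrightarrow> (\<forall>k\<le>n. \<forall>x\<in>S. (deriv ^^ k) f field_differentiable at x)"

lemma smooth_on_open_iff: "smooth_on_open S f \<longleftrightarrow> (\<forall>n. times_differentiable n S f)"
  unfolding smooth_on_open_def times_differentiable_def by blast

lemma times_differentiable_0:
  "times_differentiable 0 S f \<longleftrightarrow> (\<forall>x\<in>S. f field_differentiable at x)"
  by (simp add: times_differentiable_def)

text \<open>The innermost derivative is split off, not the outermost, so that inductions can pass
  from \<open>f\<close> to \<open>deriv f\<close>.\<close>

lemma times_differentiable_Suc:
  "times_differentiable (Suc n) S f \<longleftrightarrow>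
     (\<forall>x\<in>S. f field_differentiable at x) \<and> times_differentiable n S (deriv f)"
proof -
  have "(\<forall>k\<le>Suc n. P k) \<longleftrightarrow> P 0 \<and> (\<forall>k\<le>n. P (Suc k))" for P
    by (metis Suc_le_mono le0 not0_implies_Suc)
  then show ?thesis
    unfolding times_differentiable_def by (simp add: funpow_Suc_right del: funpow.simps)
qed

lemma times_differentiable_SucD: "times_differentiable (Suc n) S f \<Longrightarrow> times_differentiable n S f"
  by (simp add: times_differentiable_def)

text \<open>Higher derivatives at a point depend only on nearby values, so agreement on an open set
  suffices. This lets differentiation rules known only on \<open>S\<close> be used under further
  derivatives.\<close>

lemma times_differentiable_cong:
  assumes "open S" "times_differentiable n S f" "\<And>x. x \<in> S \<Longrightarrow> f x = g x"
  shows "times_differentiable n S g"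
proof -
  have "(deriv ^^ k) f x = (deriv ^^ k) g x" if "x \<in> S" for k x
    using assms(1,3) that by (intro higher_deriv_cong_ev refl) (auto simp: eventually_nhds)
  then have "(deriv ^^ k) g field_differentiable at x"
    if "(deriv ^^ k) f field_differentiable at x" "x \<in> S" for k x
    using that assms(1) has_field_derivative_transform_within_open
    unfolding field_differentiable_def by metis
  with assms(2) show ?thesis unfolding times_differentiable_def by blast
qed

lemma times_differentiable_add:
  assumes "open S" "times_differentiable n S f" "times_differentiable n S g"
  shows "times_differentiable n S (\<lambda>x. f x + g x)"
  using assms(2,3)
proof (induction n arbitrary: f g)
  case 0
  then show ?case by (auto simp: times_differentiable_0 intro!: field_differentiable_add)
next
  case (Suc n)
  then have "times_differentiable n S (\<lambda>x. deriv f x + deriv g x)"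
    by (simp add: times_differentiable_Suc)
  then have "times_differentiable n S (deriv (\<lambda>x. f x + g x))"
    by (rule times_differentiable_cong[OF assms(1)])
      (use Suc.prems in \<open>simp add: times_differentiable_Suc\<close>)
  with Suc.prems show ?case
    by (auto simp: times_differentiable_Suc intro!: field_differentiable_add)
qed

lemma times_differentiable_mult:
  assumes "open S" "times_differentiable n S f" "times_differentiable n S g"
  shows "times_differentiable n S (\<lambda>x. f x * g x)"
  using assms(2,3)
proof (induction n arbitrary: f g)
  case 0
  then show ?case by (auto simp: times_differentiable_0 intro!: field_differentiable_mult)
next
  case (Suc n)
  \<comment> \<open>By the product rule the derivative is a sum of products of \<open>n\<close>
    times differentiable functions.\<close>
  from Suc.prems have "times_differentiable n S (\<lambda>x. f x * deriv g x + deriv f x * g x)"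
    by (intro times_differentiable_add[OF assms(1)] Suc.IH)
      (blast dest: times_differentiable_SucD times_differentiable_Suc[THEN iffD1])+
  then have "times_differentiable n S (deriv (\<lambda>x. f x * g x))"
    by (rule times_differentiable_cong[OF assms(1)])
      (use Suc.prems in \<open>simp add: times_differentiable_Suc\<close>)
  with Suc.prems show ?case
    by (auto simp: times_differentiable_Suc intro!: field_differentiable_mult)
qed

lemma times_differentiable_const: "times_differentiable n S (\<lambda>_. c)"
  by (induction n arbitrary: c) (simp_all add: times_differentiable_0 times_differentiable_Suc)

lemma times_differentiable_inverse:
  assumes "open S" "times_differentiable n S f" "\<And>x. x \<in> S \<Longrightarrow> f x \<noteq> 0"
  shows "times_differentiable n S (\<lambda>x. inverse (f x))"
  using assms(2)
proof (induction n)
  case 0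
  then show ?case
    by (auto simp: times_differentiable_0 intro!: field_differentiable_inverse assms)
next
  case (Suc n)
  let ?g = "\<lambda>x. inverse (f x)"
  \<comment> \<open>This is the derivative of the reciprocal; the induction hypothesis covers the
    two factors \<open>?g\<close> at order \<open>n\<close>.\<close>
  have "times_differentiable n S (\<lambda>x. (- 1) * (deriv f x * (?g x * ?g x)))"
    using Suc.IH[OF times_differentiable_SucD[OF Suc.prems]] Suc.prems
    by (intro times_differentiable_mult[OF assms(1)] times_differentiable_const)
      (simp_all add: times_differentiable_Suc)
  moreover have "(- 1) * (deriv f x * (?g x * ?g x)) = deriv ?g x" if "x \<in> S" for x
  proof (rule DERIV_imp_deriv[symmetric])
    have "(f has_field_derivative deriv f x) (at x)"
      using Suc.prems that by (auto simp: times_differentiable_Suc intro: field_differentiable_derivI)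
    from DERIV_inverse_fun[OF this] assms(3)[OF that]
    show "(?g has_field_derivative (- 1) * (deriv f x * (?g x * ?g x))) (at x)"
      by (simp add: power2_eq_square mult_ac)
  qed
  ultimately have "times_differentiable n S (deriv ?g)"
    by (rule times_differentiable_cong[OF assms(1)])
  with Suc.prems show ?case
    by (auto simp: times_differentiable_Suc intro!: field_differentiable_inverse assms)
qed

lemma smooth_on_open_deriv: "smooth_on_open S f \<Longrightarrow> smooth_on_open S (deriv f)"
  unfolding smooth_on_open_iff using times_differentiable_Suc by blast

lemma smooth_on_open_differentiable: "smooth_on_open S f \<Longrightarrow> x \<in> S \<Longrightarrow> f field_differentiable at x"
  unfolding smooth_on_open_iff using times_differentiable_0 by blast

lemma smooth_on_open_subset: "smooth_on_open S f \<Longrightarrow> T \<subseteq> S \<Longrightarrow> smooth_on_open T f"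
  unfolding smooth_on_open_def by blast

section \<open>The ring of all germs\<close>

lemma germ_eq_iff_eventually: "germ f = germ g \<longleftrightarrow> eventually (\<lambda>x. f x = g x) at_top"
  unfolding germ_eq_iff eventually_at_top_dense ..

lemma self_in_germ: "f \<in> germ f"
  by (simp add: germ_def)

text \<open>Dropping continuity gives one ambient ring that contains the germs of interest and is
  also the underlying ring of a smooth ring, so the embedding can be the identity.\<close>

abbreviation all_germs :: "(real \<Rightarrow> real) set ring" where
  "all_germs \<equiv> germ_ring\<lparr>carrier := range germ\<rparr>"

lemma zero_germ_ring: "\<zero>\<^bsub>germ_ring\<^esub> = germ (\<lambda>_. 0)"
  and one_germ_ring: "\<one>\<^bsub>germ_ring\<^esub> = germ (\<lambda>_. 1)"
  by (simp_all add: germ_ring_def)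

lemmas germ_ring_ops = zero_germ_ring one_germ_ring add_germ_ring mult_germ_ring

lemma cring_all_germs: "cring all_germs"
proof (rule cringI)
  have "\<exists>H. (\<exists>h. H = germ h) \<and> H \<oplus>\<^bsub>germ_ring\<^esub> germ f = germ (\<lambda>_. 0)" for f
    by (rule exI[of _ "germ (\<lambda>x. - f x)"]) (auto simp: germ_ring_ops)
  then show "abelian_group all_germs"
    by (intro abelian_groupI) (auto simp: germ_ring_ops algebra_simps image_iff)
  show "comm_monoid all_germs"
    by (intro comm_monoidI) (auto simp: germ_ring_ops algebra_simps)
qed (auto simp: germ_ring_ops algebra_simps)

text \<open>
  The union over all representatives, rather than a choice of them, makes the underlying ring
  literally equal to \<open>all_germs\<close>, also at arguments that are not germs.
\<close>

definition germ_op :: "nat \<Rightarrow> (real list \<Rightarrow> real) \<Rightarrow> (real \<Rightarrow> real) set list \<Rightarrow> (real \<Rightarrow> real) set" where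
  "germ_op m h Gs = \<Union> {germ (\<lambda>t. h (map (\<lambda>f. f t) fs)) | fs. list_all2 (\<in>) fs Gs}"

text \<open>Finitely many representatives agree with \<open>us\<close> beyond a common bound, so all
  sets in the union are the same germ.\<close>

lemma germ_op_germs: "germ_op m h (map germ us) = germ (\<lambda>t. h (map (\<lambda>u. u t) us))"
proof -
  have "germ (\<lambda>t. h (map (\<lambda>f. f t) fs)) = germ (\<lambda>t. h (map (\<lambda>u. u t) us))"
    if "list_all2 (\<in>) fs (map germ us)" for fs
  proof -
    have "eventually (\<lambda>t. map (\<lambda>f. f t) fs = map (\<lambda>u. u t) us) at_top"
      using that
    proof (induction us arbitrary: fs)
      case (Cons u us)
      then obtain f gs where fs: "fs = f # gs" "f \<in> germ u" "list_all2 (\<in>) gs (map germ us)"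
        by (auto simp: list_all2_Cons2)
      from fs(2) have "eventually (\<lambda>t. u t = f t) at_top"
        by (simp add: germ_def eventually_at_top_dense)
      with Cons.IH[OF fs(3)] show ?case
        by eventually_elim (simp add: fs(1))
    qed simp
    then show ?thesis
      unfolding germ_eq_iff_eventually by eventually_elim simp
  qed
  moreover have "list_all2 (\<in>) us (map germ us)"
    by (simp add: list_all2_conv_all_nth self_in_germ)
  ultimately show ?thesis
    unfolding germ_op_def by blast
qed

text \<open>Once the arguments have representatives, each equation holds between real numbers at
  every \<open>t\<close>.\<close>

lemma cinf_ring_germs: "cinf_ring (range germ) germ_op"
proof
  have repr: "\<exists>us. Gs = map germ us" if "set Gs \<subseteq> range germ" for Gs
    using that by (metis ex_map_conv subsetD rangeE)
  fix m :: nat and cs :: "(real \<Rightarrow> real) set list"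
  assume len: "length cs = m" and "set cs \<subseteq> range germ"
  then obtain us where us: "cs = map germ us" using repr by blast
  show "germ_op m f cs \<in> range germ" for f
    by (simp add: us germ_op_germs)
  show "germ_op m (\<lambda>x. x ! j) cs = cs ! j" if "j < m" for j
    using that len by (simp add: us germ_op_germs)
  show "germ_op m h cs = germ_op n g (map (\<lambda>f. germ_op m f cs) fs)"
    if "\<And>x. length x = m \<Longrightarrow> h x = g (map (\<lambda>f. f x) fs)" for fs n g h
  proof -
    have "map (\<lambda>f. germ_op m f cs) fs = map germ (map (\<lambda>f t. f (map (\<lambda>u. u t) us)) fs)"
      by (simp add: us germ_op_germs)
    then have "germ_op n g (map (\<lambda>f. germ_op m f cs) fs) =
        germ (\<lambda>t. g (map (\<lambda>f. f (map (\<lambda>u. u t) us)) fs))"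
      by (simp only: germ_op_germs) (simp add: comp_def)
    also have "\<dots> = germ (\<lambda>t. h (map (\<lambda>u. u t) us))"
      using len by (simp add: us that)
    finally show ?thesis by (simp add: us germ_op_germs)
  qed
qed

lemma underlying_ring_germs: "underlying_ring (range germ) germ_op = all_germs"
proof -
  \<comment> \<open>Equal records need equal operations on all sets, not only on germs, so the union
    is unfolded directly.\<close>
  have "germ_op 2 h [G, H] = (\<Union>f\<in>G. \<Union>g\<in>H. germ (\<lambda>t. h [f t, g t]))" for h G H
    unfolding germ_op_def by (force simp: list_all2_Cons2)
  moreover have "germ_op 0 h [] = germ (\<lambda>_. h [])" for h
    using germ_op_germs[of 0 h "[]"] by simp
  ultimately show ?thesis
    by (simp add: underlying_ring_def germ_ring_def)
qed

section \<open>The Hardy field\<close>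

lemma smooth_unary_germs_iff:
  "G \<in> smooth_unary_germs F \<longleftrightarrow>
     (\<exists>f a. G = germ f \<and> definable_fun_on F {a<..} f \<and> smooth_on_open {a<..} f)"
proof
  assume "G \<in> smooth_unary_germs F"
  then obtain f c where f: "G = germ f" "c \<noteq> \<infinity>" "definable_fun_on F (open_interval c \<infinity>) f"
      "smooth_on_open (open_interval c \<infinity>) f"
    unfolding smooth_unary_germs_def by blast
  \<comment> \<open>If \<open>c\<close> is minus infinity, any real \<open>a\<close> will do, since
    the germ survives restriction to a smaller ray.\<close>
  obtain a where a: "{a<..} \<subseteq> open_interval c \<infinity>"
    using f(2) by (cases c) (auto simp: open_interval_def)
  show "\<exists>f a. G = germ f \<and> definable_fun_on F {a<..} f \<and> smooth_on_open {a<..} f"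
    using f definable_fun_on_subset[OF f(3) def_pred_greaterThan a] smooth_on_open_subset[OF f(4) a]
    by blast
next
  assume "\<exists>f a. G = germ f \<and> definable_fun_on F {a<..} f \<and> smooth_on_open {a<..} f"
  then obtain f a where "G = germ f" "definable_fun_on F {a<..} f" "smooth_on_open {a<..} f"
    by blast
  moreover have "{a<..} = open_interval (ereal a) \<infinity>"
    by (auto simp: open_interval_def)
  ultimately show "G \<in> smooth_unary_germs F"
    unfolding smooth_unary_germs_def
    by (metis (mono_tags, lifting) PInfty_neq_ereal(1) mem_Collect_eq)
qed

lemma smooth_unary_germsI:
  "definable_fun_on F {a<..} f \<Longrightarrow> smooth_on_open {a<..} f \<Longrightarrow> germ f \<in> smooth_unary_germs F"
  unfolding smooth_unary_germs_iff by blast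

lemma smooth_unary_germs_common_domain:
  assumes "G \<in> smooth_unary_germs F" "H \<in> smooth_unary_germs F"
  obtains f g a where "G = germ f" "H = germ g"
    "definable_fun_on F {a<..} f" "smooth_on_open {a<..} f"
    "definable_fun_on F {a<..} g" "smooth_on_open {a<..} g"
proof -
  from assms obtain f b g c where f: "G = germ f" "definable_fun_on F {b<..} f" "smooth_on_open {b<..} f"
    and g: "H = germ g" "definable_fun_on F {c<..} g" "smooth_on_open {c<..} g"
    unfolding smooth_unary_germs_iff by blast
  show thesis
  proof (rule that[of f g "max b c"])
    show "smooth_on_open {max b c<..} f" "smooth_on_open {max b c<..} g"
      by (rule smooth_on_open_subset[OF f(3)] smooth_on_open_subset[OF g(3)]; auto)+
  qed (use f g in \<open>auto intro: definable_fun_on_greaterThan_mono\<close>)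
qed

section \<open>Closure under the field operations and differentiation\<close>

lemma smooth_unary_germs_add:
  assumes "G \<in> smooth_unary_germs F" "H \<in> smooth_unary_germs F"
  shows "G \<oplus>\<^bsub>germ_ring\<^esub> H \<in> smooth_unary_germs F"
  by (rule smooth_unary_germs_common_domain[OF assms])
    (auto simp: add_germ_ring smooth_on_open_iff
      intro!: smooth_unary_germsI definable_fun_on_add times_differentiable_add)

lemma smooth_unary_germs_mult:
  assumes "G \<in> smooth_unary_germs F" "H \<in> smooth_unary_germs F"
  shows "G \<otimes>\<^bsub>germ_ring\<^esub> H \<in> smooth_unary_germs F"
  by (rule smooth_unary_germs_common_domain[OF assms])
    (auto simp: mult_germ_ring smooth_on_open_iff
      intro!: smooth_unary_germsI definable_fun_on_mult times_differentiable_mult)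

lemma smooth_unary_germs_const: "germ (\<lambda>_. r) \<in> smooth_unary_germs F"
  by (rule smooth_unary_germsI[OF definable_fun_on_const[of _ 0]])
    (simp add: smooth_on_open_iff times_differentiable_const)

text \<open>O-minimality enters the field axioms here: a nonzero germ is not eventually zero, hence
  eventually nonzero.\<close>

lemma smooth_unary_germs_inverse:
  assumes "o_minimal F" "G \<in> smooth_unary_germs F" "G \<noteq> germ (\<lambda>_. 0)"
  shows "\<exists>H\<in>smooth_unary_germs F. G \<otimes>\<^bsub>germ_ring\<^esub> H = germ (\<lambda>_. 1)"
proof -
  from assms(2) obtain f a where f: "G = germ f" "definable_fun_on F {a<..} f" "smooth_on_open {a<..} f"
    unfolding smooth_unary_germs_iff by blast
  from o_minimal_zeros[OF assms(1) f(2)] assms(3) have "eventually (\<lambda>x. f x \<noteq> 0) at_top"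
    by (auto simp: f(1) germ_eq_iff_eventually)
  then obtain b where b: "\<And>x. x > b \<Longrightarrow> f x \<noteq> 0"
    by (auto simp: eventually_at_top_dense)
  \<comment> \<open>Beyond \<open>a\<close> the function is definable and smooth, beyond
    \<open>b\<close> it has no zeros.\<close>
  define c where "c = max a b"
  have nz: "f x \<noteq> 0" if "x \<in> {c<..}" for x
    using that b by (simp add: c_def)
  have "definable_fun_on F {c<..} f"
    using f(2) by (rule definable_fun_on_greaterThan_mono) (simp add: c_def)
  then have "definable_fun_on F {c<..} (\<lambda>x. inverse (f x))"
    using nz by (rule definable_fun_on_inverse)
  moreover have "smooth_on_open {c<..} f"
    using f(3) by (rule smooth_on_open_subset) (auto simp: c_def)
  then have "smooth_on_open {c<..} (\<lambda>x. inverse (f x))"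
    using nz by (auto simp: smooth_on_open_iff intro!: times_differentiable_inverse)
  ultimately have "germ (\<lambda>x. inverse (f x)) \<in> smooth_unary_germs F"
    by (rule smooth_unary_germsI)
  moreover have "germ (\<lambda>x. f x * inverse (f x)) = germ (\<lambda>_. 1)"
    unfolding germ_eq_iff using b by (intro exI[of _ b]) simp
  ultimately show ?thesis
    unfolding f(1) mult_germ_ring[symmetric] by blast
qed

text \<open>\<open>f\<close> is an arbitrary representative and may differ from the definable
  \<open>g\<close> before some bound; beyond it they agree near each point and share
  derivatives.\<close>

lemma smooth_unary_germs_deriv:
  assumes "germ f \<in> smooth_unary_germs F"
  shows "(\<exists>c. \<forall>x>c. f field_differentiable at x) \<and> germ (deriv f) \<in> smooth_unary_germs F"
proof -
  from assms obtain g a where g: "germ f = germ g" "definable_fun_on F {a<..} g" "smooth_on_open {a<..} g"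
    unfolding smooth_unary_germs_iff by blast
  have d: "g field_differentiable at x" if "x > a" for x
    using smooth_on_open_differentiable[OF g(3)] that by simp
  from g(1) obtain b where b: "\<And>x. x > b \<Longrightarrow> f x = g x"
    unfolding germ_eq_iff by blast
  have ev: "eventually (\<lambda>y. f y = g y) (nhds x)" if "x > b" for x
    using eventually_nhds_in_open[of "{b<..}" x] that by (auto elim!: eventually_mono simp: b)
  have "f field_differentiable at x" if "x > max a b" for x
    using d[of x] that DERIV_cong_ev[OF refl ev refl, of x]
    unfolding field_differentiable_def by simp
  moreover have "germ (deriv f) = germ (deriv g)"
    unfolding germ_eq_iff using deriv_cong_ev[OF ev refl] by blast
  moreover have "germ (deriv g) \<in> smooth_unary_germs F"
    by (intro smooth_unary_germsI[of _ a] definable_fun_on_deriv smooth_on_open_deriv g(2,3) d)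
  ultimately show ?thesis by metis
qed

lemma smooth_unary_germs_subset_continuous: "smooth_unary_germs F \<subseteq> carrier germ_ring"
proof
  fix G assume "G \<in> smooth_unary_germs F"
  then obtain f a where f: "G = germ f" "smooth_on_open {a<..} f"
    unfolding smooth_unary_germs_iff by blast
  have "continuous_on {a<..} f"
    using smooth_on_open_differentiable[OF f(2)]
    by (intro continuous_at_imp_continuous_on ballI field_differentiable_imp_continuous_at)
  with f(1) show "G \<in> carrier germ_ring"
    by (auto simp: germ_ring_def)
qed

lemma subfield_smooth_unary_germs:
  assumes "o_minimal F"
  shows "subfield (smooth_unary_germs F) all_germs"
proof -
  let ?H = "smooth_unary_germs F"
  interpret cring all_germs by (rule cring_all_germs)
  have sub: "?H \<subseteq> range germ"
    unfolding smooth_unary_germs_def by blast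
  have neg: "\<ominus>\<^bsub>all_germs\<^esub> G \<in> ?H" if "G \<in> ?H" for G
  proof -
    from that sub obtain f where f: "G = germ f" by blast
    \<comment> \<open>Negation is multiplication by the constant germ of -1, so it inherits closure
      from products.\<close>
    have "germ (\<lambda>x. - 1 * f x) \<oplus>\<^bsub>all_germs\<^esub> G = \<zero>\<^bsub>all_germs\<^esub>"
      by (simp add: f germ_ring_ops)
    then have "\<ominus>\<^bsub>all_germs\<^esub> G = germ (\<lambda>x. - 1 * f x)"
      by (rule minus_equality) (simp_all add: f)
    also have "\<dots> = germ (\<lambda>_. - 1) \<otimes>\<^bsub>germ_ring\<^esub> G"
      by (simp only: f mult_germ_ring)
    also have "\<dots> \<in> ?H"
      using that by (intro smooth_unary_germs_mult smooth_unary_germs_const)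
    finally show ?thesis .
  qed
  have "subring ?H all_germs"
    by (rule subringI)
      (use sub neg in \<open>auto simp: one_germ_ring intro: smooth_unary_germs_const
        smooth_unary_germs_add smooth_unary_germs_mult\<close>)
  then have "subcring ?H all_germs" by (rule subcringI')
  \<comment> \<open>\<open>subfieldI\<close> asks that the units be exactly the nonzero elements:
    one inclusion holds because 0 and 1 have different germs, the other by the existence of
    reciprocals.\<close>
  moreover have "Units (all_germs\<lparr>carrier := ?H\<rparr>) = ?H - {\<zero>\<^bsub>all_germs\<^esub>}"
  proof (intro equalityI subsetI)
    fix G assume "G \<in> Units (all_germs\<lparr>carrier := ?H\<rparr>)"
    then obtain H where GH: "G \<in> ?H" "H \<in> ?H" "G \<otimes>\<^bsub>germ_ring\<^esub> H = germ (\<lambda>_. 1)"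
      by (auto simp: Units_def one_germ_ring)
    moreover have "G \<noteq> germ (\<lambda>_. 0)"
    proof
      assume "G = germ (\<lambda>_. 0)"
      moreover obtain h where "H = germ h" using GH(2) sub by blast
      ultimately have "germ (\<lambda>_. 0) = germ (\<lambda>_. 1)"
        using GH(3) by (simp add: mult_germ_ring)
      then show False
        by (simp add: germ_eq_iff_eventually)
    qed
    ultimately show "G \<in> ?H - {\<zero>\<^bsub>all_germs\<^esub>}"
      by (simp add: zero_germ_ring)
  next
    fix G assume G: "G \<in> ?H - {\<zero>\<^bsub>all_germs\<^esub>}"
    then obtain H where H: "H \<in> ?H" "G \<otimes>\<^bsub>germ_ring\<^esub> H = germ (\<lambda>_. 1)"
      using smooth_unary_germs_inverse[OF assms, of G] by (auto simp: zero_germ_ring)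
    moreover from this have "H \<otimes>\<^bsub>germ_ring\<^esub> G = germ (\<lambda>_. 1)"
      using m_comm[of H G] G sub by auto
    ultimately show "G \<in> Units (all_germs\<lparr>carrier := ?H\<rparr>)"
      using G by (auto simp: Units_def one_germ_ring)
  qed
  ultimately show ?thesis by (rule subfieldI)
qed

theorem theorem5:
  fixes F :: "nat \<Rightarrow> (real list \<Rightarrow> real) set"
  assumes "\<And>n. F n \<subseteq> Cinf n"
    and "o_minimal F"
  shows "hardy_field (smooth_unary_germs F) \<and>
         (\<exists>(A :: (real \<Rightarrow> real) set set) \<Phi> K.
            cinf_ring A \<Phi> \<and>
            subfield K (underlying_ring A \<Phi>) \<and>
            germ_ring\<lparr>carrier := smooth_unary_germs F\<rparr> \<simeq> (underlying_ring A \<Phi>)\<lparr>carrier := K\<rparr>)"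
proof (intro conjI exI)
  let ?H = "smooth_unary_germs F"
  interpret cring all_germs by (rule cring_all_germs)
  note H = subfield_smooth_unary_germs[OF assms(2)]
  \<comment> \<open>Replacing the carrier of \<open>all_germs\<close> by \<open>?H\<close> gives the
    same record as replacing that of \<open>germ_ring\<close>.\<close>
  have "field (germ_ring\<lparr>carrier := ?H\<rparr>)"
    using subfield_iff(2)[OF H] by simp
  then show "hardy_field ?H"
    unfolding hardy_field_def
    using smooth_unary_germs_subset_continuous smooth_unary_germs_deriv by blast
  show "cinf_ring (range germ) germ_op"
    by (rule cinf_ring_germs)
  show "subfield ?H (underlying_ring (range germ) germ_op)"
    unfolding underlying_ring_germs by (rule H)
  \<comment> \<open>\<open>K\<close> is \<open>?H\<close> itself and the underlying ring is
    \<open>all_germs\<close>, so both sides are the same ring.\<close>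
  show "germ_ring\<lparr>carrier := ?H\<rparr> \<simeq> (underlying_ring (range germ) germ_op)\<lparr>carrier := ?H\<rparr>"
    by (simp add: underlying_ring_germs ring_iso_refl)
qed

end
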